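(* Consider a strictly normal cone together with a $u$-lid, written in the expanded table $(T^+)$ with entries $\tau_{ij}$ and lid column $\tau_{i\Delta}=-s_i$ ($i=1,\dots,m$). Let $j\in\{1,\dots,n+m\}$ be a constraint plane with cutting degree $c^{\wedge}_j$, and do the pivoting at $(i^*,\Delta)$, where $i^*$ is chosen as follows: $$\text{(a)}\quad i^*=\arg\max_{i}\{s_i/\tau_{ij}\mid \tau_{ij}<0\}\quad\text{when } c^{\wedge}_j<0;$$ $$\text{(b)}\quad i^*=\arg\min_{i}\{s_i/\tau_{ij}\mid \tau_{ij}>0\}\quad\text{when } c^{\wedge}_j>0.$$ Then after the pivoting the norm vector of the $j$-th plane, i.e. the new column $(\tau'_{1j},\dots,\tau'_{mj})^T$, is non-negative in case (a) and non-positive in case (b).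
   Context: Let $A\in\mathbb{R}^{m\times n}$, let $b\in\mathbb{R}^m$ be a column vector with $b\ge0$ (standing assumption), and let $c\in\mathbb{R}^n$ be a row vector. The dual problem is $\min\{yb\mid yA\ge c,\ y\ge0\}$. Put $A^+=(A,I)$ with columns $A^+_j$ and $c^+=(c_1,\dots,c_n,0,\dots,0)\in\mathbb{R}^{n+m}$. The $n+m$ constraints are $yA_j^+\ge c_j^+$. For a base (a choice of $m$ columns of $A^+$ forming an invertible matrix $B$, with $c_B$ the corresponding entries of $c^+$), the cone is the set of points satisfying the $m$ constraints with indices in the base. Its vertex is $V=c_BB^{-1}$. The Simplex table of $B$ has entries $\tau_{ij}=(B^{-1}A^+)_{ij}$ for $i=1,\dots,m$, $j=1,\dots,n+m$, cutting degrees $c^{\wedge}_j=c^+_j-VA^+_j$ as bottom row, and slope vector $s=B^{-1}b$ as right column. The column $\tau_j=(\tau_{1j},\dots,\tau_{mj})^T$ is called the norm vector of the $j$-th plane in the table. The cone is strictly normal if $s_i>0$ for all $i=1,\dots,m$. For a given positive number $u$, the $u$-lid (the $u$-reverse horizontal plane) is the plane whose equation in the original coordinates is $-b_1y_1-\cdots-b_my_m=-u$ and in the Simplex table of $B$ is $-s_1y_1-\cdots-s_my_m=-u$. The expanded table $(T^+)$ is obtained from the Simplex table by adding an additional column for this plane, with column index $\Delta$, so that $\tau_{i\Delta}=-s_i$ for $i=1,\dots,m$. Pivoting at $(i^*,\Delta)$ is the usual Gauss–Jordan pivot operation on the table with pivot entry $\tau_{i^*\Delta}$ (here negative): row $i^*$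 is divided by $\tau_{i^*\Delta}$, and for every $i\ne i^*$, $\tau'_{ij}=\tau_{ij}-\tau_{i^*j}\tau_{i\Delta}/\tau_{i^*\Delta}$. The primed entries denote the table after pivoting. *)

theory Defs
  imports "HOL-Analysis.Analysis"
begin

text \<open>
  The $n + m$ planes are indexed by \<^typ>\<open>'n + 'm\<close>: \<^term>\<open>Inl k\<close> is the \<open>k\<close>-th column of
  \<open>A\<close>, \<^term>\<open>Inr k\<close> the \<open>k\<close>-th column of the identity block.
\<close>

definition A_plus :: "real ^ 'n ^ 'm \<Rightarrow> real ^ ('n + 'm) ^ 'm" where
  "A_plus A = (\<chi> i j. case j of Inl k \<Rightarrow> A $ i $ k | Inr k \<Rightarrow> (mat 1 :: real ^ 'm ^ 'm) $ i $ k)"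

definition c_plus :: "real ^ 'n \<Rightarrow> real ^ ('n + 'm::finite)" where
  "c_plus c = (\<chi> j. case j of Inl k \<Rightarrow> c $ k | Inr k \<Rightarrow> 0)"

text \<open>
  A base is an ordered choice \<open>\<beta>\<close> of \<open>m\<close> columns; \<^term>\<open>\<beta> i\<close> is the plane attached to the
  \<open>i\<close>-th row of the table. Invertibility forces \<open>\<beta>\<close> to be injective.
\<close>

definition base_matrix :: "real ^ 'n ^ 'm \<Rightarrow> ('m \<Rightarrow> 'n + 'm) \<Rightarrow> real ^ 'm ^ 'm" where
  "base_matrix A \<beta> = (\<chi> i k. A_plus A $ i $ \<beta> k)"

definition is_base :: "real ^ 'n ^ 'm \<Rightarrow> ('m \<Rightarrow> 'n + 'm) \<Rightarrow> bool" where
  "is_base A \<beta> \<longleftrightarrow> invertible (base_matrix A \<beta>)"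

definition base_cost :: "real ^ 'n \<Rightarrow> ('m::finite \<Rightarrow> 'n + 'm) \<Rightarrow> real ^ 'm" where
  "base_cost c \<beta> = (\<chi> k. c_plus c $ \<beta> k)"

definition vertex :: "real ^ 'n ^ 'm \<Rightarrow> real ^ 'n \<Rightarrow> ('m \<Rightarrow> 'n + 'm) \<Rightarrow> real ^ 'm" where
  "vertex A c \<beta> = base_cost c \<beta> v* matrix_inv (base_matrix A \<beta>)"

definition tau :: "real ^ 'n ^ 'm \<Rightarrow> ('m \<Rightarrow> 'n + 'm) \<Rightarrow> real ^ ('n + 'm) ^ 'm" where
  "tau A \<beta> = matrix_inv (base_matrix A \<beta>) ** A_plus A"

definition cutting_degree ::
    "real ^ 'n ^ 'm \<Rightarrow> real ^ 'n \<Rightarrow> ('m \<Rightarrow> 'n + 'm) \<Rightarrow> 'n + 'm \<Rightarrow> real" where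
  "cutting_degree A c \<beta> j = c_plus c $ j - vertex A c \<beta> \<bullet> column j (A_plus A)"

definition slope :: "real ^ 'n ^ 'm \<Rightarrow> real ^ 'm \<Rightarrow> ('m \<Rightarrow> 'n + 'm) \<Rightarrow> real ^ 'm" where
  "slope A b \<beta> = matrix_inv (base_matrix A \<beta>) *v b"

definition strictly_normal :: "real ^ 'n ^ 'm \<Rightarrow> real ^ 'm \<Rightarrow> ('m \<Rightarrow> 'n + 'm) \<Rightarrow> bool" where
  "strictly_normal A b \<beta> \<longleftrightarrow> (\<forall>i. slope A b \<beta> $ i > 0)"

datatype 'm table_row = Row 'm | Bottom

datatype 'p table_col = Plane 'p | Lid | Right

text \<open>
  The \<open>u\<close>-lid is the plane $y(-b) = -u$, so its column has the entries
  $B^{-1}(-b) = -s$ and the cutting degree $-u - V(-b)$, by the same formulas as for the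
  columns of $A^+$. The corner entry (bottom row, right column) is the usual $-Vb$.
\<close>

fun expanded_table ::
    "real ^ 'n ^ 'm \<Rightarrow> real ^ 'm \<Rightarrow> real ^ 'n \<Rightarrow> real \<Rightarrow> ('m \<Rightarrow> 'n + 'm) \<Rightarrow>
      'm table_row \<Rightarrow> ('n + 'm) table_col \<Rightarrow> real" where
  "expanded_table A b c u \<beta> (Row i) (Plane j) = tau A \<beta> $ i $ j"
| "expanded_table A b c u \<beta> (Row i) Lid = - slope A b \<beta> $ i"
| "expanded_table A b c u \<beta> (Row i) Right = slope A b \<beta> $ i"
| "expanded_table A b c u \<beta> Bottom (Plane j) = cutting_degree A c \<beta> j"
| "expanded_table A b c u \<beta> Bottom Lid = - u - vertex A c \<beta> \<bullet> (- b)"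
| "expanded_table A b c u \<beta> Bottom Right = - (vertex A c \<beta> \<bullet> b)"

lemma expanded_table_Lid_eq:
  "expanded_table A b c u \<beta> (Row i) Lid = (matrix_inv (base_matrix A \<beta>) *v (- b)) $ i"
  by (simp add: slope_def matrix_vector_mult_def sum_negf)

definition pivot :: "('r \<Rightarrow> 'c \<Rightarrow> real) \<Rightarrow> 'r \<Rightarrow> 'c \<Rightarrow> 'r \<Rightarrow> 'c \<Rightarrow> real" where
  "pivot T r q i j =
     (if i = r then T r j / T r q else T i j - T r j * T i q / T r q)"

end

theory Submission imports Defs begin

text \<open>
  The lid column is \<open>-s\<close> with every \<open>s i > 0\<close>. Write \<open>t\<close> for the column of the \<open>j\<close>-th plane and
  \<open>r\<close> for the pivot row. Pivoting replaces \<open>t r\<close> by \<open>- t r / s r\<close>, and for \<open>i \<noteq> r\<close> it replaces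
  \<open>t i\<close> by \<open>t i - t r * s i / s r = s i * (t i / s i - t r / s r)\<close>. Hence the new column is
  non-negative as soon as \<open>t r\<close> is negative and \<open>r\<close> minimises \<open>t i / s i\<close> over all rows.

  The rule of case (a) provides exactly this (\<open>arg_max_ratio_imp_least_quotient\<close>): inversion
  reverses the order of the negative numbers, so a row with the greatest \<open>s i / t i\<close> among those
  with \<open>t i < 0\<close> has the least \<open>t i / s i\<close>, and every remaining row has \<open>t i / s i \<ge> 0\<close>.
  Case (b) is case (a) for the column \<open>-t\<close>.
\<close>

text \<open>
  Rows with \<open>t i \<ge> 0\<close> cannot compete with the negative quotient \<open>t r / s r\<close>; on the other rows
  both \<open>s i / t i\<close> and \<open>s r / t r\<close> are negative, so inverting them reverses their order.
\<close>

lemma arg_max_ratio_imp_least_quotient: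
  fixes s t :: "'a \<Rightarrow> real"
  assumes s: "\<And>i. 0 < s i"
    and r: "is_arg_max (\<lambda>i. s i / t i) (\<lambda>i. t i < 0) r"
  shows "t r < 0" and "t r / s r \<le> t i / s i"
proof -
  show tr: "t r < 0"
    using r by (simp add: is_arg_max_def)
  show "t r / s r \<le> t i / s i"
  proof (cases "t i < 0")
    case True
    then have "s i / t i \<le> s r / t r"
      using r by (auto simp: is_arg_max_linorder)
    moreover have "s r / t r < 0"
      using s tr by (simp add: divide_pos_neg)
    ultimately have "inverse (s r / t r) \<le> inverse (s i / t i)"
      by (rule le_imp_inverse_le_neg)
    then show ?thesis
      by simp
  next
    case False
    then have "0 \<le> t i / s i"
      using s[of i] by simp
    moreover have "t r / s r < 0"
      using s tr by (simp add: divide_neg_pos)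
    ultimately show ?thesis
      by simp
  qed
qed

lemma arg_min_ratio_imp_greatest_quotient:
  fixes s t :: "'a \<Rightarrow> real"
  assumes s: "\<And>i. 0 < s i"
    and r: "is_arg_min (\<lambda>i. s i / t i) (\<lambda>i. t i > 0) r"
  shows "t r > 0" and "t i / s i \<le> t r / s r"
proof -
  have "is_arg_max (\<lambda>i. s i / - t i) (\<lambda>i. - t i < 0) r"
    using r by (simp add: is_arg_max_def is_arg_min_def)
  note least = arg_max_ratio_imp_least_quotient[where t = "\<lambda>i. - t i", OF s this]
  show "t r > 0" and "t i / s i \<le> t r / s r"
    using least(1) least(2)[of i] by simp_all
qed

text \<open>
  The factored form turns the sign of a new entry into a comparison of two quotients. The map \<open>f\<close>
  picks out the rows in which the pivot column is \<open>-s\<close>, which need not be all rows of a table.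
\<close>

lemma pivot_negative_column:
  assumes q: "\<And>i. T (f i) q = - s i"
    and s: "\<And>i. 0 < s i"
    and f: "inj f"
  shows "pivot T (f r) q (f i) p =
    (if i = r then - (T (f r) p / s r)
     else s i * (T (f i) p / s i - T (f r) p / s r))"
  using s[of i] s[of r] f by (simp add: pivot_def q inj_eq field_simps)

theorem theorem4p2:
  fixes A :: "real ^ 'n ^ 'm"
    and b :: "real ^ 'm"
    and c :: "real ^ 'n"
    and u :: real
    and \<beta> :: "'m \<Rightarrow> 'n + 'm"
    and j :: "'n + 'm"
    and istar :: 'm
    and T T' :: "'m table_row \<Rightarrow> ('n + 'm) table_col \<Rightarrow> real"
  assumes "\<forall>i. 0 \<le> b $ i"
    and "is_base A \<beta>"
    and "strictly_normal A b \<beta>"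
    and "u > 0"
    and "T = expanded_table A b c u \<beta>"
    and "T' = pivot T (Row istar) Lid"
  shows "(cutting_degree A c \<beta> j < 0 \<and>
          is_arg_max (\<lambda>i. slope A b \<beta> $ i / T (Row i) (Plane j)) (\<lambda>i. T (Row i) (Plane j) < 0) istar
            \<longrightarrow> (\<forall>i. T' (Row i) (Plane j) \<ge> 0)) \<and>
         (cutting_degree A c \<beta> j > 0 \<and>
          is_arg_min (\<lambda>i. slope A b \<beta> $ i / T (Row i) (Plane j)) (\<lambda>i. T (Row i) (Plane j) > 0) istar
            \<longrightarrow> (\<forall>i. T' (Row i) (Plane j) \<le> 0))"
proof -
  have s: "\<And>i. 0 < slope A b \<beta> $ i"
    using assms(3) by (simp add: strictly_normal_def)
  have "inj (Row :: 'm \<Rightarrow> 'm table_row)"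
    by (simp add: inj_def)
  moreover have "\<And>i. T (Row i) Lid = - slope A b \<beta> $ i"
    by (simp add: assms(5))
  ultimately have T': "T' (Row i) (Plane j) =
      (if i = istar then - (T (Row istar) (Plane j) / slope A b \<beta> $ istar)
       else slope A b \<beta> $ i *
         (T (Row i) (Plane j) / slope A b \<beta> $ i
          - T (Row istar) (Plane j) / slope A b \<beta> $ istar))" for i
    using s unfolding assms(6) by (intro pivot_negative_column)
  show ?thesis
  proof (intro conjI impI allI; elim conjE)
    fix i
    assume "is_arg_max (\<lambda>i. slope A b \<beta> $ i / T (Row i) (Plane j))
      (\<lambda>i. T (Row i) (Plane j) < 0) istar"
    note least = arg_max_ratio_imp_least_quotient[OF s this]
    show "T' (Row i) (Plane j) \<ge> 0"
      using least(1) least(2)[of i] s[of i]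
      by (auto simp: T' divide_nonpos_pos)
  next
    fix i
    assume "is_arg_min (\<lambda>i. slope A b \<beta> $ i / T (Row i) (Plane j))
      (\<lambda>i. T (Row i) (Plane j) > 0) istar"
    note greatest = arg_min_ratio_imp_greatest_quotient[OF s this]
    show "T' (Row i) (Plane j) \<le> 0"
      using greatest(1) greatest(2)[of i] s[of i]
      by (auto simp: T' mult_nonneg_nonpos)
  qed
qed

end
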